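(* Let $g,q,b\in\mathbb{R}$, $\alpha>0$, let $u_\alpha$ be the solution of $(S_\alpha)$, and let $u^h_\alpha$ be its piecewise linear discrete approximation. Then for each mesh size $h=x_0/n$, $n\ge1$ an integer, $$\|u_\alpha-u^h_\alpha\|_H\le C_{1\alpha}h,\qquad \left\|\frac{\partial u_\alpha}{\partial x}-\frac{\partial u^h_\alpha}{\partial x}\right\|_H\le\widetilde{C_1}\,h,$$ where $C_{1\alpha}=|g|x_0\sqrt{x_0y_0\left(\tfrac2{15}+\tfrac23\tfrac1{\alpha x_0}+\tfrac1{\alpha^2x_0^2}\right)}$ and $\widetilde{C_1}=|g|\sqrt{\tfrac13x_0y_0}$ are constants independent of $h$.
   Context: Fix $x_0,y_0>0$, $\Omega=(0,x_0)\times(0,y_0)$, $\Gamma_1=\{0\}\times(0,y_0]$, $\Gamma_2=\{x_0\}\times(0,y_0]$, $\Gamma_3=[0,x_0]\times\{0,y_0\}$, and $H=L^2(\Omega)$ with its standard norm. For constants $g,q,b\in\mathbb{R}$ and $\alpha>0$, system $(S_\alpha)$ is $-\Delta u=g$ in $\Omega$, $-\partial u/\partial n=\alpha(u-b)$ on $\Gamma_1$, $-\partial u/\partial n=q$ on $\Gamma_2$, $-\partial u/\partial n=0$ on $\Gamma_3$ ($n$ the outward normal); its solution is $u_\alpha(x,y)=-\tfrac12gx^2+(gx_0-q)x+\tfrac1\alpha(gx_0-q)+b$. For an integer $n\ge1$ put $h=x_0/n$, $x_i=(i-1)h$, $i=1,\dots,n+1$. The discrete system $(S^h_\alpha)$ is: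 $u^h_{\alpha,2}-u^h_{\alpha,1}=\alpha h(u^h_{\alpha,1}-b)$; $u^h_{\alpha,i+1}-2u^h_{\alpha,i}+u^h_{\alpha,i-1}=-gh^2$ for $i=2,\dots,n$; $u^h_{\alpha,n+1}-u^h_{\alpha,n}=-qh$. The function $u^h_\alpha$ is the piecewise linear interpolant of its solution: $u^h_\alpha(x,y)=(gx_0-q-hgi)x+b+\tfrac{gx_0-q}{\alpha}-\tfrac{gh}{\alpha}+\tfrac{i^2-i}{2}gh^2$ for $x\in[x_i,x_{i+1}]$, $y\in[0,y_0]$, $i=1,\dots,n$; $\partial u^h_\alpha/\partial x$ is piecewise constant, defined a.e. *)

theory Defs
  imports "HOL-Analysis.Analysis"
begin

section \<open>The rectangle and its boundary\<close>

definition Omega :: "real \<Rightarrow> real \<Rightarrow> (real \<times> real) set" where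
  "Omega x0 y0 = {0<..<x0} \<times> {0<..<y0}"

definition Gamma1 :: "real \<Rightarrow> (real \<times> real) set" where
  "Gamma1 y0 = {0} \<times> {0<..y0}"

definition Gamma2 :: "real \<Rightarrow> real \<Rightarrow> (real \<times> real) set" where
  "Gamma2 x0 y0 = {x0} \<times> {0<..y0}"

text \<open>The third boundary part \<open>[0, x0] \<times> {0, y0}\<close> is split into its lower and upper
  edge, whose outward normals differ.\<close>

definition Gamma3_low :: "real \<Rightarrow> (real \<times> real) set" where
  "Gamma3_low x0 = {0..x0} \<times> {0}"

definition Gamma3_up :: "real \<Rightarrow> real \<Rightarrow> (real \<times> real) set" where
  "Gamma3_up x0 y0 = {0..x0} \<times> {y0}"

section \<open>The space \<open>L\<^sup>2\<close>\<close>

text \<open>Elements are functions, not classes modulo null sets. Lebesgue (not Borel) measurability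
  is used, so changing a function on a null set affects neither membership nor norm.\<close>

definition L2 :: "'a::euclidean_space set \<Rightarrow> ('a \<Rightarrow> real) set" where
  "L2 S = {f. f \<in> borel_measurable (lebesgue_on S) \<and> integrable (lebesgue_on S) (\<lambda>p. (f p)\<^sup>2)}"

text \<open>Only meaningful for \<open>f \<in> L2 S\<close>: otherwise the Bochner integral may be a dummy value.\<close>

definition L2_norm :: "'a::euclidean_space set \<Rightarrow> ('a \<Rightarrow> real) \<Rightarrow> real" where
  "L2_norm S f = sqrt (\<integral>p. (f p)\<^sup>2 \<partial>(lebesgue_on S))"

section \<open>Derivatives\<close>

text \<open>Arbitrary values at points where the partial derivative does not exist.\<close>

definition partial_x :: "(real \<times> real \<Rightarrow> real) \<Rightarrow> real \<times> real \<Rightarrow> real" where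
  "partial_x u p = deriv (\<lambda>x. u (x, snd p)) (fst p)"

definition partial_y :: "(real \<times> real \<Rightarrow> real) \<Rightarrow> real \<times> real \<Rightarrow> real" where
  "partial_y u p = deriv (\<lambda>y. u (fst p, y)) (snd p)"

definition laplacian :: "(real \<times> real \<Rightarrow> real) \<Rightarrow> real \<times> real \<Rightarrow> real" where
  "laplacian u p = partial_x (partial_x u) p + partial_y (partial_y u) p"

definition C1_on :: "(real \<times> real) set \<Rightarrow> (real \<times> real \<Rightarrow> real) \<Rightarrow> bool" where
  "C1_on S u \<longleftrightarrow> (\<forall>p\<in>S. u differentiable (at p))
     \<and> continuous_on S (partial_x u) \<and> continuous_on S (partial_y u)"

definition C2_on :: "(real \<times> real) set \<Rightarrow> (real \<times> real \<Rightarrow> real) \<Rightarrow> bool" where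
  "C2_on S u \<longleftrightarrow> C1_on S u \<and> C1_on S (partial_x u) \<and> C1_on S (partial_y u)"

text \<open>Derivative at a boundary point \<open>p\<close> in the outward direction \<open>\<nu>\<close>. It is one-sided,
  evaluating \<open>u\<close> only at points \<open>p + t \<nu>\<close> with \<open>t \<le> 0\<close>, i.e. in the closed domain.\<close>

definition has_normal_derivative ::
    "(real \<times> real \<Rightarrow> real) \<Rightarrow> real \<Rightarrow> real \<times> real \<Rightarrow> real \<times> real \<Rightarrow> bool" where
  "has_normal_derivative u d \<nu> p \<longleftrightarrow>
     ((\<lambda>t. u (p + t *\<^sub>R \<nu>)) has_real_derivative d) (at_left 0)"

section \<open>The continuous problem\<close>

text \<open>Classical solutions: twice continuously differentiable inside, continuous up to the boundary,
  with the boundary conditions in the sense of one-sided normal derivatives. At a corner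
  belonging to two edges the condition of each of them is imposed, with its own normal.\<close>

definition solves_S ::
    "real \<Rightarrow> real \<Rightarrow> real \<Rightarrow> real \<Rightarrow> real \<Rightarrow> real \<Rightarrow> (real \<times> real \<Rightarrow> real) \<Rightarrow> bool" where
  "solves_S x0 y0 g q b \<alpha> u \<longleftrightarrow>
     C2_on (Omega x0 y0) u \<and> continuous_on (closure (Omega x0 y0)) u \<and>
     (\<forall>p\<in>Omega x0 y0. - laplacian u p = g) \<and>
     (\<forall>p\<in>Gamma1 y0. \<exists>d. has_normal_derivative u d (-1, 0) p \<and> - d = \<alpha> * (u p - b)) \<and>
     (\<forall>p\<in>Gamma2 x0 y0. \<exists>d. has_normal_derivative u d (1, 0) p \<and> - d = q) \<and>
     (\<forall>p\<in>Gamma3_low x0. \<exists>d. has_normal_derivative u d (0, -1) p \<and> - d = 0) \<and>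
     (\<forall>p\<in>Gamma3_up x0 y0. \<exists>d. has_normal_derivative u d (0, 1) p \<and> - d = 0)"

section \<open>The discrete problem\<close>

text \<open>Only the values \<open>U 1, \<dots>, U (n + 1)\<close> matter.\<close>

definition solves_Sh ::
    "real \<Rightarrow> nat \<Rightarrow> real \<Rightarrow> real \<Rightarrow> real \<Rightarrow> real \<Rightarrow> (nat \<Rightarrow> real) \<Rightarrow> bool" where
  "solves_Sh h n g q b \<alpha> U \<longleftrightarrow>
     U 2 - U 1 = \<alpha> * h * (U 1 - b) \<and>
     (\<forall>i\<in>{2..n}. U (i + 1) - 2 * U i + U (i - 1) = - g * h\<^sup>2) \<and>
     U (n + 1) - U n = - q * h"

definition node :: "real \<Rightarrow> nat \<Rightarrow> real" where
  "node h i = (real i - 1) * h"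

text \<open>The interpolant is affine in \<open>x\<close> between consecutive nodes, constant in \<open>y\<close>, and takes the
  value \<open>U i\<close> at the \<open>i\<close>-th node.\<close>

definition pl_interpolant ::
    "real \<Rightarrow> nat \<Rightarrow> real \<Rightarrow> (nat \<Rightarrow> real) \<Rightarrow> (real \<times> real \<Rightarrow> real) \<Rightarrow> bool" where
  "pl_interpolant h n y0 U uh \<longleftrightarrow>
     (\<forall>i\<in>{1..n}. \<forall>x\<in>{node h i..node h (i + 1)}. \<forall>y\<in>{0..y0}.
        uh (x, y) = U i + (U (i + 1) - U i) / h * (x - node h i))"

section \<open>Existence of solutions\<close>

lemma solves_S_explicit:
  assumes "x0 > 0" "y0 > 0" "\<alpha> > 0"
  shows "solves_S x0 y0 g q b \<alpha>
    (\<lambda>(x, y). - (1/2) * g * x\<^sup>2 + (g * x0 - q) * x + (1/\<alpha>) * (g * x0 - q) + b)"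
    (is "solves_S _ _ _ _ _ _ ?u")
proof -
  have u: "?u = (\<lambda>p. - (1/2) * g * (fst p)\<^sup>2 + (g * x0 - q) * fst p + (1/\<alpha>) * (g * x0 - q) + b)"
    by (auto simp: fun_eq_iff)
  have px: "partial_x ?u = (\<lambda>p. - g * fst p + (g * x0 - q))"
    unfolding partial_x_def
    by (auto simp: fun_eq_iff intro!: DERIV_imp_deriv derivative_eq_intros)
  have py: "partial_y ?u = (\<lambda>p. 0)"
    unfolding partial_y_def by (auto simp: fun_eq_iff intro!: DERIV_imp_deriv)
  have pxx: "partial_x (\<lambda>p. - g * fst p + (g * x0 - q)) = (\<lambda>p. - g)"
    unfolding partial_x_def
    by (auto simp: fun_eq_iff intro!: DERIV_imp_deriv derivative_eq_intros)
  have pxy: "partial_y (\<lambda>p. - g * fst p + (g * x0 - q)) = (\<lambda>p. 0)"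
    unfolding partial_y_def by (auto simp: fun_eq_iff intro!: DERIV_imp_deriv)
  have p0: "partial_x (\<lambda>p. 0) = (\<lambda>p. 0)" "partial_y (\<lambda>p. 0) = (\<lambda>p. 0)"
    unfolding partial_x_def partial_y_def by (auto simp: fun_eq_iff intro!: DERIV_imp_deriv)
  have diff: "?u differentiable (at p)" for p
    unfolding u differentiable_def by (rule exI) (rule derivative_eq_intros refl)+
  have diff1: "(\<lambda>p::real \<times> real. - g * fst p + (g * x0 - q)) differentiable (at p)" for p
    unfolding differentiable_def by (rule exI) (rule derivative_eq_intros refl)+
  have C2: "C2_on (Omega x0 y0) ?u"
    unfolding C2_on_def C1_on_def px py pxx pxy p0
    using diff diff1 by (auto intro!: continuous_intros)
  have cont: "continuous_on (closure (Omega x0 y0)) ?u"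
    unfolding u by (intro continuous_intros)
  have lap: "- laplacian ?u p = g" for p
    by (simp only: laplacian_def px py pxx p0)
  have n1: "has_normal_derivative ?u (- (g * x0 - q)) (-1, 0) (0, y)" for y
    unfolding has_normal_derivative_def by (auto intro!: derivative_eq_intros)
  have n2: "has_normal_derivative ?u (- q) (1, 0) (x0, y)" for y
    unfolding has_normal_derivative_def by (auto intro!: derivative_eq_intros)
  have n3: "has_normal_derivative ?u 0 (0, d) p" for d p
    unfolding has_normal_derivative_def by (cases p) (auto intro!: derivative_eq_intros)
  have b1: "\<exists>d. has_normal_derivative ?u d (-1, 0) p \<and> - d = \<alpha> * (?u p - b)"
    if *: "p \<in> Gamma1 y0" for p
  proof (intro exI conjI)
    obtain y where p: "p = (0, y)" using * by (auto simp: Gamma1_def)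
    show "has_normal_derivative ?u (- (g * x0 - q)) (-1, 0) p" unfolding p by (rule n1)
    show "- (- (g * x0 - q)) = \<alpha> * (?u p - b)" unfolding p using \<open>\<alpha> > 0\<close> by simp
  qed
  have b2: "\<exists>d. has_normal_derivative ?u d (1, 0) p \<and> - d = q"
    if *: "p \<in> Gamma2 x0 y0" for p
  proof (intro exI conjI)
    obtain y where p: "p = (x0, y)" using * by (auto simp: Gamma2_def)
    show "has_normal_derivative ?u (- q) (1, 0) p" unfolding p by (rule n2)
  qed simp
  have b3: "\<exists>d. has_normal_derivative ?u d (0, e) p \<and> - d = 0" for e p
    by (intro exI[of _ 0] conjI n3) simp
  show ?thesis
    unfolding solves_S_def by (intro conjI ballI C2 cont lap b1 b2 b3; assumption)
qed

lemma solves_Sh_explicit: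
  fixes h :: real
  assumes "x0 > 0" "\<alpha> > 0" "n \<ge> 1" "h = x0 / real n"
  shows "solves_Sh h n g q b \<alpha>
    (\<lambda>i. (g * x0 - q - h * g * i) * node h i + b + (g * x0 - q) / \<alpha> - g * h / \<alpha>
         + (real i ^ 2 - real i) / 2 * g * h\<^sup>2)"
proof -
  have x0: "x0 = h * n" using assms by simp
  show ?thesis
    unfolding solves_Sh_def node_def x0 using assms(2)
    by (auto simp: of_nat_diff field_simps power2_eq_square)
qed

lemma pl_interpolant_exists:
  assumes "h > 0"
  shows "\<exists>uh. pl_interpolant h n y0 U uh"
proof -
  define k where "k x = nat \<lfloor>x / h\<rfloor> + 1" for x
  define uh where "uh p = U (k (fst p)) + (U (k (fst p) + 1) - U (k (fst p))) / h
    * (fst p - node h (k (fst p)))" for p :: "real \<times> real"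
  have "uh (x, y) = U i + (U (i + 1) - U i) / h * (x - node h i)"
    if "i \<in> {1..n}" "x \<in> {node h i..node h (i + 1)}" for i x y
  proof (cases "x = node h (i + 1)")
    case True
    then have "k x = i + 1" using assms by (simp add: k_def node_def)
    with True show ?thesis using assms by (simp add: uh_def node_def field_simps)
  next
    case False
    with that have "real i - 1 \<le> x / h" "x / h < real i"
      using assms by (auto simp: node_def field_simps)
    then have "\<lfloor>x / h\<rfloor> = int i - 1" by (simp add: floor_eq_iff)
    then have "k x = i" using that by (auto simp: k_def nat_diff_distrib)
    then show ?thesis by (simp add: uh_def)
  qed
  then show ?thesis unfolding pl_interpolant_def by blast
qed

end

theory Submission
  imports Defs
begin

text \<open>
  Both errors can be computed exactly, because the two problems have explicit solutions which depend
  on \<open>x\<close> only. For the continuous problem this requires uniqueness among all classical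
  solutions (\<open>solves_S_comparison\<close>): the difference of two solutions, perturbed by a small multiple of
  a strictly superharmonic barrier, can attain its maximum only on the Robin part of the boundary,
  and there the Robin condition bounds it by that small multiple. The discrete problem is solved by
  summing its increments.

  Write \<open>s\<close> for the offset of \<open>x\<close> from the mesh node on its left. Subtracting the two solutions
  gives \<open>u - u\<^sup>h = g h (1/\<alpha> + x/2 + s (h - s) / (2 h))\<close> (\<open>interpolation_error\<close>), and
  differentiating gives \<open>g (h - s)\<close> away from the nodes. The square of the latter has integral
  \<open>g\<^sup>2 h\<^sup>3 / 3\<close> over each of the \<open>n\<close> cells, hence \<open>g\<^sup>2 h\<^sup>2 x0 / 3\<close> in total, so that the second
  estimate is in fact an equality. For the first, \<open>s (h - s) / h\<close> is at most
  \<open>x (x0 - x) / x0\<close>, its value for the mesh with a single cell (\<open>error_profile_bound\<close>). This replaces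
  the profile by the polynomial \<open>1/\<alpha> + x - x\<^sup>2 / (2 x0)\<close>, the integral of whose square is
  \<open>x0\<^sup>3 (2/15 + 2/(3 \<alpha> x0) + 1/(\<alpha>\<^sup>2 x0\<^sup>2))\<close>. Integration over \<open>y\<close> contributes the factor \<open>y0\<close>.
\<close>


section \<open>Uniqueness for the continuous problem\<close>

lemma real_derivative_at_left_max:
  fixes f :: "real \<Rightarrow> real"
  assumes "(f has_real_derivative d) (at_left 0)" and "\<forall>\<^sub>F t in at_left 0. f t \<le> f 0"
  shows "0 \<le> d"
proof (rule tendsto_lowerbound)
  show "((\<lambda>t. (f t - f 0) / (t - 0)) \<longlongrightarrow> d) (at_left 0)"
    using assms(1) by (simp add: has_field_derivative_iff)
  show "\<forall>\<^sub>F t in at_left 0. 0 \<le> (f t - f 0) / (t - 0)"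
  proof -
    have "\<forall>\<^sub>F t in at_left (0 :: real). t < 0"
      by (simp add: eventually_at_filter)
    with assms(2) show ?thesis
      by eventually_elim (simp add: divide_nonpos_neg)
  qed
qed simp

text \<open>The second derivative test under weak smoothness: \<open>f'\<close> need only be differentiable at \<open>x\<close>
  itself. If \<open>D > 0\<close>, then \<open>f'\<close> is positive just to the right of its zero \<open>x\<close>, and the mean value
  theorem makes \<open>f\<close> exceed \<open>f x\<close> there.\<close>

lemma second_derivative_nonpos_at_local_max:
  fixes f f' :: "real \<Rightarrow> real"
  assumes "d > 0"
    and f: "\<And>t. \<bar>t - x\<bar> < d \<Longrightarrow> (f has_real_derivative f' t) (at t)"
    and f': "(f' has_real_derivative D) (at x)"
    and max: "\<And>t. \<bar>t - x\<bar> < d \<Longrightarrow> f t \<le> f x"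
  shows "D \<le> 0"
proof (rule ccontr)
  assume "\<not> D \<le> 0"
  then obtain e where e: "e > 0" "\<And>h. 0 < h \<Longrightarrow> h < e \<Longrightarrow> f' x < f' (x + h)"
    using DERIV_pos_inc_right[OF f'] by auto
  have "f' x = 0"
    using DERIV_local_max[OF f[of x] \<open>d > 0\<close>] max \<open>d > 0\<close> by (simp add: abs_minus_commute)
  define y where "y = x + min d e / 2"
  have y: "x < y" "y < x + d" "y < x + e" using \<open>d > 0\<close> e(1) by (auto simp: y_def min_def)
  obtain z where z: "x < z" "z < y" "f y - f x = (y - x) * f' z"
    using MVT2[of x y f f'] y f by auto
  have "0 < f' z" using e(2)[of "z - x"] z y \<open>f' x = 0\<close> by auto
  then show False using z y max[of y] by (smt (verit) mult_pos_pos)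
qed

lemma partial_x_has_derivative:
  assumes "u differentiable (at (x, y))"
  shows "((\<lambda>t. u (t, y)) has_real_derivative partial_x u (x, y)) (at x)"
proof -
  have "(\<lambda>t. (t, y)) differentiable (at x)"
    unfolding differentiable_def by (rule exI) (rule derivative_eq_intros refl)+
  then have "(\<lambda>t. u (t, y)) differentiable (at x)"
    using differentiable_chain_at[of "\<lambda>t. (t, y)" x u] assms by (simp add: o_def)
  then show ?thesis
    by (simp add: partial_x_def DERIV_deriv_iff_real_differentiable)
qed

lemma partial_y_has_derivative:
  assumes "u differentiable (at (x, y))"
  shows "((\<lambda>t. u (x, t)) has_real_derivative partial_y u (x, y)) (at y)"
proof -
  have "(\<lambda>t. (x, t)) differentiable (at y)"
    unfolding differentiable_def by (rule exI) (rule derivative_eq_intros refl)+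
  then have "(\<lambda>t. u (x, t)) differentiable (at y)"
    using differentiable_chain_at[of "\<lambda>t. (x, t)" y u] assms by (simp add: o_def)
  then show ?thesis
    by (simp add: partial_y_def DERIV_deriv_iff_real_differentiable)
qed

lemma closure_Omega:
  assumes "x0 > 0" "y0 > 0"
  shows "closure (Omega x0 y0) = {0..x0} \<times> {0..y0}"
  using assms by (simp add: Omega_def closure_Times)

text \<open>The maximum principle, with a barrier in place of the Hopf boundary lemma, which would need a
  separate treatment of the corners. The auxiliary function
  \<open>\<psi> = (4 x0 + 1) x - 2 x\<^sup>2 + (y - y0/2)\<^sup>2\<close> satisfies \<open>\<Delta>\<psi> = -2 < 0\<close>, and its normal derivative
  is positive on the two Neumann parts: \<open>1\<close> on \<open>\<Gamma>\<^sub>2\<close> and \<open>y0\<close> on \<open>\<Gamma>\<^sub>3\<close>. Therefore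
  \<open>v = u1 - u2 - e \<psi>\<close> with \<open>e > 0\<close> has \<open>\<Delta>v > 0\<close> and strictly negative normal derivatives on the
  Neumann parts, so it can attain its maximum over the closed rectangle only on \<open>\<Gamma>\<^sub>1\<close>. There the
  Robin condition bounds \<open>u1 - u2\<close> by a multiple of \<open>e\<close>, because the normal derivative of \<open>v\<close> at a
  maximum is nonnegative. All four corners lie in \<open>\<Gamma>\<^sub>3\<close> and are excluded by its condition.
  Letting \<open>e\<close> tend to \<open>0\<close> gives the claim.\<close>

lemma solves_S_comparison:
  assumes pos: "x0 > 0" "y0 > 0" "\<alpha> > 0"
    and S1: "solves_S x0 y0 g q b \<alpha> u1" and S2: "solves_S x0 y0 g q b \<alpha> u2"
    and z: "z \<in> closure (Omega x0 y0)"
  shows "u1 z \<le> u2 z"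
proof -
  define L where "L = 4 * x0 + 1"
  define \<psi> where "\<psi> p = L * fst p - 2 * (fst p)\<^sup>2 + (snd p - y0 / 2)\<^sup>2" for p :: "real \<times> real"
  let ?R = "closure (Omega x0 y0)"
  note R = closure_Omega[OF pos(1,2)]
  have \<psi>_nonneg: "0 \<le> \<psi> p" if "p \<in> ?R" for p
  proof -
    have "0 \<le> fst p * (L - 2 * fst p)"
      using that pos by (auto simp: R L_def intro!: mult_nonneg_nonneg)
    then have "0 \<le> L * fst p - 2 * (fst p)\<^sup>2"
      by (simp add: algebra_simps power2_eq_square)
    then show ?thesis by (simp add: \<psi>_def)
  qed
  have key: "u1 z - u2 z \<le> e * (L / \<alpha> + \<psi> z)" if "e > 0" for e
  proof -
    define v where "v p = u1 p - u2 p - e * \<psi> p" for p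
    have cont: "continuous_on ?R v"
      using S1 S2 unfolding solves_S_def v_def \<psi>_def by (auto intro!: continuous_intros)
    have comp: "compact ?R" unfolding R by (intro compact_Times compact_Icc)
    have ne: "?R \<noteq> {}" using z by (metis empty_iff)
    obtain p where p: "p \<in> ?R" and max: "\<And>r. r \<in> ?R \<Longrightarrow> v r \<le> v p"
      using continuous_attains_sup[OF comp ne cont] by metis
    obtain x y where xy: "p = (x, y)" by (cases p)
    have bounds: "0 \<le> x" "x \<le> x0" "0 \<le> y" "y \<le> y0" using p by (auto simp: R xy)
    have normal: "0 \<le> d1 - d2 - e * d"
      if "has_normal_derivative u1 d1 \<nu> p" "has_normal_derivative u2 d2 \<nu> p"
        "has_normal_derivative \<psi> d \<nu> p"
        and inside: "\<forall>\<^sub>F t in at_left 0. p + t *\<^sub>R \<nu> \<in> ?R" for d1 d2 d \<nu>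
    proof (rule real_derivative_at_left_max)
      show "((\<lambda>t. v (p + t *\<^sub>R \<nu>)) has_real_derivative d1 - d2 - e * d) (at_left 0)"
        using that unfolding has_normal_derivative_def v_def by (intro DERIV_diff DERIV_cmult)
      show "\<forall>\<^sub>F t in at_left 0. v (p + t *\<^sub>R \<nu>) \<le> v (p + 0 *\<^sub>R \<nu>)"
        using inside by eventually_elim (simp add: max)
    qed
    have y_low: "y \<noteq> 0"
    proof
      assume "y = 0"
      then have "p \<in> Gamma3_low x0" using bounds by (simp add: Gamma3_low_def xy)
      then have "has_normal_derivative u1 0 (0, -1) p" "has_normal_derivative u2 0 (0, -1) p"
        using S1 S2 unfolding solves_S_def by auto
      moreover have "has_normal_derivative \<psi> y0 (0, -1) p"
        unfolding has_normal_derivative_def \<psi>_def xy \<open>y = 0\<close>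
        by (auto intro!: derivative_eq_intros)
      moreover have "\<forall>\<^sub>F t in at_left 0. p + t *\<^sub>R (0, -1) \<in> ?R"
        using eventually_at_left_real[of "-y0" 0] pos(2)
        by (auto elim!: eventually_mono simp: R xy \<open>y = 0\<close> bounds)
      ultimately have "0 \<le> 0 - 0 - e * y0" by (rule normal)
      then show False using \<open>e > 0\<close> pos(2) mult_pos_pos[of e y0] by linarith
    qed
    have y_up: "y \<noteq> y0"
    proof
      assume "y = y0"
      then have "p \<in> Gamma3_up x0 y0" using bounds by (simp add: Gamma3_up_def xy)
      then have "has_normal_derivative u1 0 (0, 1) p" "has_normal_derivative u2 0 (0, 1) p"
        using S1 S2 unfolding solves_S_def by auto
      moreover have "has_normal_derivative \<psi> y0 (0, 1) p"
        unfolding has_normal_derivative_def \<psi>_def xy \<open>y = y0\<close>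
        by (auto intro!: derivative_eq_intros)
      moreover have "\<forall>\<^sub>F t in at_left 0. p + t *\<^sub>R (0, 1) \<in> ?R"
        using eventually_at_left_real[of "-y0" 0] pos(2)
        by (auto elim!: eventually_mono simp: R xy \<open>y = y0\<close> bounds)
      ultimately have "0 \<le> 0 - 0 - e * y0" by (rule normal)
      then show False using \<open>e > 0\<close> pos(2) mult_pos_pos[of e y0] by linarith
    qed
    have x_right: "x \<noteq> x0"
    proof
      assume "x = x0"
      then have "p \<in> Gamma2 x0 y0" using bounds y_low by (simp add: Gamma2_def xy)
      then have "has_normal_derivative u1 (-q) (1, 0) p" "has_normal_derivative u2 (-q) (1, 0) p"
        using S1 S2 unfolding solves_S_def by (metis minus_minus)+
      moreover have "has_normal_derivative \<psi> 1 (1, 0) p"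
        unfolding has_normal_derivative_def \<psi>_def xy \<open>x = x0\<close> L_def
        by (auto intro!: derivative_eq_intros)
      moreover have "\<forall>\<^sub>F t in at_left 0. p + t *\<^sub>R (1, 0) \<in> ?R"
        using eventually_at_left_real[of "-x0" 0] pos(1)
        by (auto elim!: eventually_mono simp: R xy \<open>x = x0\<close> bounds)
      ultimately have "0 \<le> -q - -q - e * 1" by (rule normal)
      then show False using \<open>e > 0\<close> by linarith
    qed
    have x_left: "x = 0"
    proof (rule ccontr)
      assume "x \<noteq> 0"
      then have pO: "p \<in> Omega x0 y0"
        using bounds y_low y_up x_right by (auto simp: Omega_def xy)
      define \<delta> where "\<delta> = Min {x, x0 - x, y, y0 - y}"
      have \<delta>: "\<delta> > 0" using bounds \<open>x \<noteq> 0\<close> y_low y_up x_right by (auto simp: \<delta>_def)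
      have inx: "(t, y) \<in> Omega x0 y0" if "\<bar>t - x\<bar> < \<delta>" for t
        using that pO by (auto simp: \<delta>_def Omega_def xy)
      have iny: "(x, t) \<in> Omega x0 y0" if "\<bar>t - y\<bar> < \<delta>" for t
        using that pO by (auto simp: \<delta>_def Omega_def xy)
      have sub: "r \<in> ?R" if "r \<in> Omega x0 y0" for r using that closure_subset by blast
      have diff: "u1 differentiable (at r)" "partial_x u1 differentiable (at r)"
        "partial_y u1 differentiable (at r)" "u2 differentiable (at r)"
        "partial_x u2 differentiable (at r)" "partial_y u2 differentiable (at r)"
        if "r \<in> Omega x0 y0" for r
        using S1 S2 that unfolding solves_S_def C2_on_def C1_on_def by auto
      have "partial_x (partial_x u1) p - partial_x (partial_x u2) p - e * (- 4) \<le> 0"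
      proof (rule second_derivative_nonpos_at_local_max[OF \<delta>])
        show "((\<lambda>t. v (t, y)) has_real_derivative
            partial_x u1 (t, y) - partial_x u2 (t, y) - e * (L - 4 * t)) (at t)"
          if "\<bar>t - x\<bar> < \<delta>" for t
          using diff[OF inx[OF that]] unfolding v_def \<psi>_def
          by (auto intro!: derivative_eq_intros partial_x_has_derivative)
        show "((\<lambda>t. partial_x u1 (t, y) - partial_x u2 (t, y) - e * (L - 4 * t)) has_real_derivative
            partial_x (partial_x u1) p - partial_x (partial_x u2) p - e * (- 4)) (at x)"
          using diff[OF pO] unfolding xy
          by (auto intro!: derivative_eq_intros partial_x_has_derivative)
        show "v (t, y) \<le> v (x, y)" if "\<bar>t - x\<bar> < \<delta>" for t
          using max[OF sub[OF inx[OF that]]] by (simp add: xy)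
      qed
      moreover have "partial_y (partial_y u1) p - partial_y (partial_y u2) p - e * 2 \<le> 0"
      proof (rule second_derivative_nonpos_at_local_max[OF \<delta>])
        show "((\<lambda>t. v (x, t)) has_real_derivative
            partial_y u1 (x, t) - partial_y u2 (x, t) - e * (2 * t - y0)) (at t)"
          if "\<bar>t - y\<bar> < \<delta>" for t
          using diff[OF iny[OF that]] unfolding v_def \<psi>_def
          by (auto intro!: derivative_eq_intros partial_y_has_derivative)
        show "((\<lambda>t. partial_y u1 (x, t) - partial_y u2 (x, t) - e * (2 * t - y0)) has_real_derivative
            partial_y (partial_y u1) p - partial_y (partial_y u2) p - e * 2) (at y)"
          using diff[OF pO] unfolding xy
          by (auto intro!: derivative_eq_intros partial_y_has_derivative)
        show "v (x, t) \<le> v (x, y)" if "\<bar>t - y\<bar> < \<delta>" for t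
          using max[OF sub[OF iny[OF that]]] by (simp add: xy)
      qed
      moreover have "- laplacian u1 p = g" "- laplacian u2 p = g"
        using S1 S2 pO unfolding solves_S_def by auto
      ultimately show False using \<open>e > 0\<close> unfolding laplacian_def by linarith
    qed
    have "p \<in> Gamma1 y0" using bounds y_low by (simp add: Gamma1_def xy x_left)
    then have "has_normal_derivative u1 (- (\<alpha> * (u1 p - b))) (-1, 0) p"
        "has_normal_derivative u2 (- (\<alpha> * (u2 p - b))) (-1, 0) p"
      using S1 S2 unfolding solves_S_def by (metis minus_minus)+
    moreover have "has_normal_derivative \<psi> (- L) (-1, 0) p"
      unfolding has_normal_derivative_def \<psi>_def xy x_left
      by (auto intro!: derivative_eq_intros)
    moreover have "\<forall>\<^sub>F t in at_left 0. p + t *\<^sub>R (-1, 0) \<in> ?R"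
      using eventually_at_left_real[of "-x0" 0] pos(1)
      by (auto elim!: eventually_mono simp: R xy x_left bounds)
    ultimately have "0 \<le> - (\<alpha> * (u1 p - b)) - - (\<alpha> * (u2 p - b)) - e * - L" by (rule normal)
    then have "u1 p - u2 p \<le> e * L / \<alpha>" using pos(3) by (simp add: field_simps)
    moreover have "0 \<le> e * \<psi> p" using \<psi>_nonneg[OF p] \<open>e > 0\<close> by simp
    ultimately show ?thesis using max[OF z] by (simp add: v_def algebra_simps)
  qed
  have C: "0 < L / \<alpha> + \<psi> z" using pos \<psi>_nonneg[OF z] by (simp add: L_def add_pos_nonneg)
  have "u1 z - u2 z \<le> 0"
  proof (rule field_le_epsilon)
    fix e :: real assume "0 < e"
    then show "u1 z - u2 z \<le> 0 + e"
      using key[of "e / (L / \<alpha> + \<psi> z)"] C by simp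
  qed
  then show ?thesis by simp
qed


lemma solves_S_unique:
  assumes pos: "x0 > 0" "y0 > 0" "\<alpha> > 0"
    and S: "solves_S x0 y0 g q b \<alpha> u"
    and p: "(x, y) \<in> Omega x0 y0"
  shows "u (x, y) = - (1/2) * g * x\<^sup>2 + (g * x0 - q) * x + (1/\<alpha>) * (g * x0 - q) + b"
proof -
  note E = solves_S_explicit[OF pos, of g q b]
  have "(x, y) \<in> closure (Omega x0 y0)" using p closure_subset by blast
  from solves_S_comparison[OF pos S E this] solves_S_comparison[OF pos E S this]
  show ?thesis by simp
qed

section \<open>The discrete solution and the pointwise error\<close>

text \<open>The difference equation prescribes how the increments change, and the condition at the right end
  prescribes the last one, so they are found by descending from \<open>i = n\<close>.\<close>

lemma solves_Sh_increment:
  assumes S: "solves_Sh h n g q b \<alpha> U" and "1 \<le> i" "i \<le> n"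
  shows "U (i + 1) - U i = h * (- q + (real n - real i) * g * h)"
  using assms(3,2)
proof (induction i rule: inc_induct)
  case base
  show ?case using S by (simp add: solves_Sh_def)
next
  case (step i)
  have "U (Suc i + 1) - 2 * U (Suc i) + U (Suc i - 1) = - g * h\<^sup>2"
  proof -
    have "Suc i \<in> {2..n}" using step by auto
    then show ?thesis using S unfolding solves_Sh_def by blast
  qed
  moreover have "U (Suc i + 1) - U (Suc i) = h * (- q + (real n - real (Suc i)) * g * h)"
    using step by simp
  ultimately show ?case by (simp add: algebra_simps power2_eq_square)
qed

lemma solves_Sh_values:
  assumes S: "solves_Sh h n g q b \<alpha> U" and "h > 0" "\<alpha> > 0" "n \<ge> 1"
    and "1 \<le> i" "i \<le> n + 1"
  shows "U i = b + (- q + (real n - 1) * g * h) / \<alpha>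
    + (real i - 1) * h * (- q + real n * g * h) - g * h\<^sup>2 * real i * (real i - 1) / 2"
  using assms(5,6)
proof (induction i rule: dec_induct)
  case base
  have "h * (\<alpha> * (U 1 - b)) = U (1 + 1) - U 1"
    using S by (simp add: solves_Sh_def numeral_2_eq_2 mult_ac)
  also have "\<dots> = h * (- q + (real n - 1) * g * h)"
    using solves_Sh_increment[OF S, of 1] assms by simp
  finally have "\<alpha> * (U 1 - b) = - q + (real n - 1) * g * h"
    using \<open>h > 0\<close> by (simp only: mult_cancel_left) auto
  then have "U 1 - b = (- q + (real n - 1) * g * h) / \<alpha>"
    using \<open>\<alpha> > 0\<close> by (simp add: field_simps)
  then show ?case by simp
next
  case (step i)
  then have "U (Suc i) = U i + h * (- q + (real n - real i) * g * h)"
    using solves_Sh_increment[OF S, of i] by simp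
  also have "U i = b + (- q + (real n - 1) * g * h) / \<alpha>
    + (real i - 1) * h * (- q + real n * g * h) - g * h\<^sup>2 * real i * (real i - 1) / 2"
    using step by simp
  finally show ?case by (simp add: algebra_simps power2_eq_square add_divide_distrib diff_divide_distrib)
qed

definition cell_offset :: "real \<Rightarrow> real \<Rightarrow> real" where
  "cell_offset h x = h * frac (x / h)"

text \<open>The function \<open>u - u\<^sup>h\<close> in closed form. The offset \<open>s\<close> of \<open>x\<close> from the node on its left
  enters through \<open>s (h - s)\<close>, the defect of linear interpolation of a parabola on one cell; the terms
  \<open>1 / \<alpha>\<close> and \<open>x / 2\<close> come from the first-order treatment of the two boundary conditions.\<close>

definition error_profile :: "real \<Rightarrow> real \<Rightarrow> real \<Rightarrow> real \<Rightarrow> real" where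
  "error_profile g \<alpha> h x =
     g * h * (1 / \<alpha> + x / 2 + cell_offset h x * (h - cell_offset h x) / (2 * h))"

lemma cell_offset_eq:
  assumes "h > 0" "real k * h \<le> x" "x < (real k + 1) * h"
  shows "cell_offset h x = x - real k * h"
proof -
  have "\<lfloor>x / h\<rfloor> = int k" using assms by (simp add: floor_eq_iff field_simps)
  then show ?thesis using assms by (simp add: cell_offset_def frac_def field_simps)
qed

text \<open>The cells are numbered from \<open>0\<close>, as is natural for the floor function; cell \<open>k\<close> starts at
  \<open>node h (k + 1)\<close>.\<close>

lemma mesh_cell:
  assumes "h > 0" "0 \<le> x" "x < real n * h"
  obtains k where "k < n" "real k * h \<le> x" "x < (real k + 1) * h" 
    "cell_offset h x = x - real k * h"
proof
  let ?k = "nat \<lfloor>x / h\<rfloor>"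
  have "0 \<le> x / h" using assms by simp
  then have k: "real ?k = of_int \<lfloor>x / h\<rfloor>" by simp
  have *: "real ?k \<le> x / h" "x / h < real ?k + 1" unfolding k by linarith+
  then show 1: "real ?k * h \<le> x" "x < (real ?k + 1) * h"
    by (simp_all only: pos_le_divide_eq[OF assms(1)] pos_divide_less_eq[OF assms(1)])
  then show "cell_offset h x = x - real ?k * h" by (rule cell_offset_eq[OF assms(1)])
  have "x / h < real n" using assms by (simp add: pos_divide_less_eq)
  then have "real ?k < real n" using *(1) by linarith
  then show "?k < n" by (simp only: of_nat_less_iff)
qed

lemma interpolation_error:
  assumes "x0 > 0" "\<alpha> > 0" "n \<ge> 1" and h: "h = x0 / real n"
    and S: "solves_Sh h n g q b \<alpha> U" and I: "pl_interpolant h n y0 U uh"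
    and x: "0 < x" "x < x0" and y: "0 < y" "y < y0"
  shows "uh (x, y) = - (1/2) * g * x\<^sup>2 + (g * x0 - q) * x + (1/\<alpha>) * (g * x0 - q) + b
    - error_profile g \<alpha> h x"
proof -
  have "h > 0" and x0: "x0 = real n * h" using assms by (simp_all add: h)
  obtain k where k: "k < n" "real k * h \<le> x" "x < (real k + 1) * h" 
    "cell_offset h x = x - real k * h"
    using mesh_cell[of h x n] \<open>h > 0\<close> x by (auto simp: x0)
  have "k + 1 \<in> {1..n}" "x \<in> {node h (k + 1)..node h (k + 1 + 1)}" "y \<in> {0..y0}"
    using k(1-3) y by (auto simp: node_def algebra_simps)
  then have "uh (x, y) = U (k + 1) + (U (k + 1 + 1) - U (k + 1)) / h * (x - node h (k + 1))"
    using I unfolding pl_interpolant_def by blast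
  also have "\<dots> = U (k + 1) + (- q + (real n - real (k + 1)) * g * h) * (x - real k * h)"
    using solves_Sh_increment[OF S, of "k + 1"] k(1) \<open>h > 0\<close> by (simp add: node_def)
  also have "U (k + 1) = b + (- q + (real n - 1) * g * h) / \<alpha>
    + real k * h * (- q + real n * g * h) - g * h\<^sup>2 * (real k + 1) * real k / 2"
    using solves_Sh_values[OF S \<open>h > 0\<close> assms(2,3), of "k + 1"] k(1) by (simp add: add.commute)
  finally have "uh (x, y) = b + (- q + (real n - 1) * g * h) / \<alpha>
    + real k * h * (- q + real n * g * h) - g * h\<^sup>2 * (real k + 1) * real k / 2
    + (- q + (real n - real (k + 1)) * g * h) * (x - real k * h)" .
  moreover have "error_profile g \<alpha> h x
    = g * h / \<alpha> + g * h * x / 2 + g * (x - real k * h) * (h - (x - real k * h)) / 2"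
    using \<open>h > 0\<close> unfolding error_profile_def k(4)
    by (simp add: field_simps)
  ultimately show ?thesis
    using \<open>\<alpha> > 0\<close> unfolding x0
    by (simp add: field_simps power2_eq_square)
qed

lemma error_profile_derivative:
  assumes "h > 0" "real k * h < x" "x < (real k + 1) * h"
  shows "(error_profile g \<alpha> h has_real_derivative g * ((real k + 1) * h - x)) (at x)"
proof -
  have "((\<lambda>t. g * h * (1 / \<alpha> + t / 2 + (t - real k * h) * (h - (t - real k * h)) / (2 * h)))
      has_real_derivative g * ((real k + 1) * h - x)) (at x)"
    using \<open>h > 0\<close> by (auto intro!: derivative_eq_intros simp: field_simps)
  then show ?thesis
  proof (rule has_field_derivative_transform_within_open)
    show "open {real k * h<..<(real k + 1) * h}" by simp
  qed (use assms in \<open>auto simp: error_profile_def cell_offset_eq[where k = k]\<close>)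
qed

text \<open>For \<open>r = h - s\<close> the quantity \<open>s r / (s + r)\<close> is monotone in both \<open>s\<close> and \<open>r\<close>. Since
  \<open>s \<le> x\<close> and \<open>r \<le> x0 - x\<close>, the defect \<open>s (h - s) / (2 h)\<close> on the mesh is at most the defect
  \<open>x (x0 - x) / (2 x0)\<close> of the coarsest mesh \<open>n = 1\<close>. The polynomial on the right is the error
  profile of that mesh without its factor \<open>g h\<close>.\<close>

lemma error_profile_bound:
  assumes "x0 > 0" "\<alpha> > 0" "n \<ge> 1" and h: "h = x0 / real n" and x: "0 < x" "x < x0"
  shows "(error_profile g \<alpha> h x)\<^sup>2 \<le> (g * h)\<^sup>2 * (1 / \<alpha> + x - x\<^sup>2 / (2 * x0))\<^sup>2"
proof -
  have "h > 0" and x0: "x0 = real n * h" using assms by (simp_all add: h)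
  obtain k where k: "k < n" "real k * h \<le> x" "x < (real k + 1) * h" 
    "cell_offset h x = x - real k * h"
    using mesh_cell[of h x n] \<open>h > 0\<close> x by (auto simp: x0)
  define s r where "s = cell_offset h x" and "r = h - s"
  have "0 \<le> real k * h" using \<open>h > 0\<close> by simp
  moreover have "(real k + 1) * h \<le> real n * h" using k(1) \<open>h > 0\<close> by (intro mult_right_mono) auto
  moreover have "(real k + 1) * h = real k * h + h" by (simp add: algebra_simps)
  ultimately have s: "0 \<le> s" "s \<le> x" and r: "0 \<le> r" "r \<le> x0 - x"
    using k(2-4) unfolding s_def r_def x0 by linarith+
  have "s * r * x \<le> s * (x0 - x) * x" "s * r * (x0 - x) \<le> x * r * (x0 - x)"
    using s r x by (auto intro!: mult_right_mono mult_left_mono)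
  then have "s * r * x0 \<le> x * (x0 - x) * h"
    by (simp add: algebra_simps r_def)
  then have "s * r / (2 * h) \<le> x * (x0 - x) / (2 * x0)"
    using \<open>h > 0\<close> \<open>x0 > 0\<close> by (simp add: field_simps)
  also have "\<dots> = x / 2 - x\<^sup>2 / (2 * x0)"
    using \<open>x0 > 0\<close> by (simp add: field_simps power2_eq_square)
  finally have "(1 / \<alpha> + x / 2 + s * r / (2 * h)) \<le> 1 / \<alpha> + x - x\<^sup>2 / (2 * x0)" by simp
  moreover have "0 \<le> 1 / \<alpha> + x / 2 + s * r / (2 * h)" using s r x \<open>h > 0\<close> \<open>\<alpha> > 0\<close> by simp
  ultimately have "(1 / \<alpha> + x / 2 + s * r / (2 * h))\<^sup>2 \<le> (1 / \<alpha> + x - x\<^sup>2 / (2 * x0))\<^sup>2"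
    by (intro power_mono)
  then show ?thesis
    by (auto simp: error_profile_def power_mult_distrib s_def r_def intro!: mult_left_mono)
qed

section \<open>Integration over the mesh and over the rectangle\<close>

lemma has_integral_mesh:
  fixes f :: "real \<Rightarrow> real"
  assumes "h > 0" and "\<And>k. k < n \<Longrightarrow> (f has_integral J) {real k * h..(real k + 1) * h}"
  shows "(f has_integral real n * J) {0..real n * h}"
  using assms(2)
proof (induction n)
  case 0
  then show ?case using has_integral_refl(2)[of f 0] by simp
next
  case (Suc n)
  have "(f has_integral (real n * J + J)) {0..(real n + 1) * h}"
    by (rule has_integral_combine[where c = "real n * h"])
       (use Suc \<open>h > 0\<close> in \<open>auto intro!: mult_right_mono\<close>)
  then show ?case by (simp add: algebra_simps)
qed

text \<open>Functions on the rectangle that depend only on \<open>x\<close> have an \<open>L\<^sup>2\<close> norm computed by a single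
  integral, by Fubini. The majorant \<open>G\<close> lets an inequality for \<open>F\<^sup>2\<close> replace the exact integral of a
  piecewise defined function.\<close>

lemma L2_norm_le_fst:
  assumes "y0 > 0"
    and F[measurable]: "F \<in> borel_measurable borel" and G[measurable]: "G \<in> borel_measurable borel"
    and I: "(G has_integral I) {0..x0}"
    and le: "\<And>x. 0 < x \<Longrightarrow> x < x0 \<Longrightarrow> (F x)\<^sup>2 \<le> G x"
    and w: "\<And>p. p \<in> Omega x0 y0 \<Longrightarrow> w p = F (fst p)"
  shows "w \<in> L2 (Omega x0 y0) \<and> L2_norm (Omega x0 y0) w \<le> sqrt (y0 * I)"
proof -
  let ?O = "Omega x0 y0"
  define A where "A x = indicator {0<..<x0} x * G x" for x
  define B :: "real \<Rightarrow> real" where "B = indicator {0<..<y0}"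
  define P where "P p = A (fst p) * B (snd p)" for p
  define Q where "Q p = indicator ?O p * (F (fst p))\<^sup>2" for p
  have O[measurable]: "?O \<in> sets borel" by (simp add: Omega_def open_Times borel_open)
  have [measurable]: "fst \<in> borel_measurable (borel :: (real \<times> real) measure)"
    by (intro borel_measurable_continuous_onI continuous_intros)
  have [measurable]: "A \<in> borel_measurable borel" "B \<in> borel_measurable borel"
    "Q \<in> borel_measurable borel" unfolding A_def B_def Q_def by measurable
  have nonneg: "0 \<le> G x" if "x \<in> {0<..<x0}" for x
    using le[of x] that by (smt (verit) greaterThanLessThan_iff zero_le_power2)
  have I': "(G has_integral I) {0<..<x0}" using I by (simp add: has_integral_Icc_iff_Ioo)
  have "G absolutely_integrable_on {0<..<x0}"
    using I' nonneg by (intro nonnegative_absolutely_integrable_1) auto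
  then have "integrable lebesgue A" by (simp add: set_integrable_def A_def[abs_def])
  then have intA: "integrable lborel A" by (subst (asm) integrable_completion) auto
  have "(A has_integral I) UNIV"
  proof -
    have "A = (\<lambda>x. if x \<in> {0<..<x0} then G x else 0)" by (auto simp: A_def fun_eq_iff)
    then show ?thesis using I' by (simp only: has_integral_restrict_UNIV)
  qed
  then have A: "integral\<^sup>L lborel A = I"
    using has_integral_integral_lborel[OF intA] has_integral_unique by blast
  have intB: "integrable lborel B" and B: "integral\<^sup>L lborel B = y0"
    using \<open>y0 > 0\<close> by (simp_all add: B_def)
  have "integrable (lborel \<Otimes>\<^sub>M lborel) P"
  proof (rule lborel_pair.Fubini_integrable)
    show "P \<in> borel_measurable (lborel \<Otimes>\<^sub>M lborel)" unfolding P_def by measurable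
    show "integrable lborel (\<lambda>x. \<integral>y. norm (P (x, y)) \<partial>lborel)"
      using intA intB by (simp add: P_def abs_mult)
    show "AE x in lborel. integrable lborel (\<lambda>y. P (x, y))"
      using intB by (simp add: P_def)
  qed
  moreover from lborel_pair.integral_fst'[OF this]
  have "integral\<^sup>L (lborel \<Otimes>\<^sub>M lborel) P = I * y0"
    by (simp add: P_def A B)
  ultimately have intP: "integrable lborel P" and P: "integral\<^sup>L lborel P = y0 * I"
    by (simp_all add: lborel_prod)
  have QP: "0 \<le> Q p" "Q p \<le> P p" for p
    using le[of "fst p"] by (cases p; auto simp: Q_def P_def A_def B_def Omega_def indicator_def)+
  have intQ: "integrable lborel Q"
  proof (rule Bochner_Integration.integrable_bound[OF intP])
    show "AE p in lborel. norm (Q p) \<le> norm (P p)"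
      using QP by (intro AE_I2) (metis abs_of_nonneg order_trans real_norm_def)
  qed simp
  have wQ: "indicator ?O p * (w p)\<^sup>2 = Q p" for p
    using w by (auto simp: Q_def indicator_def)
  have w_meas: "w \<in> borel_measurable (lebesgue_on ?O)"
  proof -
    have "(\<lambda>p :: real \<times> real. F (fst p)) \<in> borel_measurable lborel" by measurable
    then have "(\<lambda>p. F (fst p)) \<in> borel_measurable (lebesgue_on ?O)"
      by (intro measurable_restrict_space1 measurable_completion)
    then show ?thesis by (subst measurable_cong[where g = "\<lambda>p. F (fst p)"]) (auto simp: w)
  qed
  have "integrable (lebesgue_on ?O) (\<lambda>p. (w p)\<^sup>2)"
    using intQ by (subst integrable_restrict_space) (simp_all add: wQ integrable_completion)
  moreover have "(\<integral>p. (w p)\<^sup>2 \<partial>lebesgue_on ?O) = integral\<^sup>L lborel Q"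
    by (subst integral_restrict_space) (simp_all add: wQ integral_completion)
  moreover have "integral\<^sup>L lborel Q \<le> integral\<^sup>L lborel P"
    by (rule integral_mono[OF intQ intP]) (rule QP)
  ultimately show ?thesis using w_meas by (simp add: L2_def L2_norm_def P)
qed

text \<open>For \<open>c = 1 / \<alpha>\<close> this value times \<open>g\<^sup>2 y0\<close> is \<open>C\<^bsub>1\<alpha>\<^esub>\<^sup>2\<close>.\<close>

lemma has_integral_error_majorant:
  fixes x0 c :: real
  assumes "x0 > 0"
  shows "((\<lambda>x. (c + x - x\<^sup>2 / (2 * x0))\<^sup>2) has_integral
     x0 ^ 3 * (2/15 + 2/3 * (c / x0) + c\<^sup>2 / x0\<^sup>2)) {0..x0}"
proof -
  define k where "k = 1 / (2 * x0)"
  define A where "A x = c\<^sup>2 * x + c * x\<^sup>2 + (1 - 2 * c * k) * x ^ 3 / 3 - k * x ^ 4 / 2 + k\<^sup>2 * x ^ 5 / 5" for x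
  have "((\<lambda>x. (c + x - x\<^sup>2 / (2 * x0))\<^sup>2) has_integral A x0 - A 0) {0..x0}"
  proof (rule fundamental_theorem_of_calculus)
    fix x
    have "(A has_real_derivative (c + x - k * x\<^sup>2)\<^sup>2) (at x)"
      unfolding A_def by (auto intro!: derivative_eq_intros simp: field_simps power2_eq_square power_numeral_reduce)
    then show "(A has_vector_derivative (c + x - x\<^sup>2 / (2 * x0))\<^sup>2) (at x within {0..x0})"
      by (simp add: k_def has_real_derivative_iff_has_vector_derivative has_vector_derivative_at_within)
  qed (use assms in auto)
  also have "A x0 - A 0 = x0 ^ 3 * (2/15 + 2/3 * (c / x0) + c\<^sup>2 / x0\<^sup>2)"
    using assms by (simp add: A_def k_def field_simps power_numeral_reduce power2_eq_square)
  finally show ?thesis .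
qed


section \<open>The error estimates\<close>

theorem lemma2:
  fixes x0 y0 g q b \<alpha> h :: real and n :: nat
    and u uh :: "real \<times> real \<Rightarrow> real" and U :: "nat \<Rightarrow> real"
  assumes "x0 > 0" and "y0 > 0" and "\<alpha> > 0" and "n \<ge> 1" and "h = x0 / real n"
    and "solves_S x0 y0 g q b \<alpha> u"
    and "solves_Sh h n g q b \<alpha> U"
    and "pl_interpolant h n y0 U uh"
  shows "(\<lambda>p. u p - uh p) \<in> L2 (Omega x0 y0) \<and>
    L2_norm (Omega x0 y0) (\<lambda>p. u p - uh p)
      \<le> \<bar>g\<bar> * x0 * sqrt (x0 * y0 * (2/15 + 2/3 * (1 / (\<alpha> * x0)) + 1 / (\<alpha>\<^sup>2 * x0\<^sup>2))) * h \<and>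
    (\<lambda>p. partial_x u p - partial_x uh p) \<in> L2 (Omega x0 y0) \<and>
    L2_norm (Omega x0 y0) (\<lambda>p. partial_x u p - partial_x uh p)
      \<le> \<bar>g\<bar> * sqrt (1/3 * x0 * y0) * h"
proof -
  have "h > 0" and x0: "x0 = real n * h" using assms(1,4) by (simp_all add: assms(5))
  define \<phi> where "\<phi> x = - (1/2) * g * x\<^sup>2 + (g * x0 - q) * x + (1/\<alpha>) * (g * x0 - q) + b" for x
  define E where "E = error_profile g \<alpha> h"
  have frac_meas[measurable]: "frac \<in> borel_measurable (borel :: real measure)"
    unfolding frac_def[abs_def] by measurable
  have s_meas[measurable]: "cell_offset h \<in> borel_measurable borel"
    unfolding cell_offset_def[abs_def] by measurable
  have E_meas[measurable]: "E \<in> borel_measurable borel"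
    unfolding E_def error_profile_def[abs_def] by measurable
  have u: "u (x, y) = \<phi> x" if "(x, y) \<in> Omega x0 y0" for x y
    using solves_S_unique[OF assms(1-3,6) that] by (simp add: \<phi>_def)
  have uh: "uh (x, y) = \<phi> x - E x" if "(x, y) \<in> Omega x0 y0" for x y
    using interpolation_error[OF assms(1,3-5,7,8)] that by (simp add: \<phi>_def E_def Omega_def)
  have near: "\<forall>\<^sub>F t in nhds x. (t, y) \<in> Omega x0 y0" if "(x, y) \<in> Omega x0 y0" for x y
    using that eventually_nhds_in_open[of "{0<..<x0}" x]
    by (auto simp: Omega_def elim!: eventually_mono)

  have "((\<lambda>x. (g * h)\<^sup>2 * (1 / \<alpha> + x - x\<^sup>2 / (2 * x0))\<^sup>2) has_integral
      (g * h)\<^sup>2 * (x0 ^ 3 * (2/15 + 2/3 * (1 / \<alpha> / x0) + (1 / \<alpha>)\<^sup>2 / x0\<^sup>2))) {0..x0}"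
    by (intro has_integral_mult_right has_integral_error_majorant assms)
  then have "(\<lambda>p. u p - uh p) \<in> L2 (Omega x0 y0) \<and> L2_norm (Omega x0 y0) (\<lambda>p. u p - uh p) \<le>
      sqrt (y0 * ((g * h)\<^sup>2 * (x0 ^ 3 * (2/15 + 2/3 * (1 / \<alpha> / x0) + (1 / \<alpha>)\<^sup>2 / x0\<^sup>2))))"
  proof (rule L2_norm_le_fst[OF assms(2) E_meas, rotated])
    show "(E x)\<^sup>2 \<le> (g * h)\<^sup>2 * (1 / \<alpha> + x - x\<^sup>2 / (2 * x0))\<^sup>2" if "0 < x" "x < x0" for x
      unfolding E_def by (rule error_profile_bound[OF assms(1,3-5) that])
  qed (auto simp: u uh)
  also have "y0 * ((g * h)\<^sup>2 * (x0 ^ 3 * (2/15 + 2/3 * (1 / \<alpha> / x0) + (1 / \<alpha>)\<^sup>2 / x0\<^sup>2)))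
      = (\<bar>g\<bar> * x0 * h)\<^sup>2 * (x0 * y0 * (2/15 + 2/3 * (1 / (\<alpha> * x0)) + 1 / (\<alpha>\<^sup>2 * x0\<^sup>2)))"
    by (simp add: power_mult_distrib power_divide power3_eq_cube power2_eq_square)
  also have "sqrt \<dots> = \<bar>g\<bar> * x0 * sqrt (x0 * y0 * (2/15 + 2/3 * (1 / (\<alpha> * x0)) + 1 / (\<alpha>\<^sup>2 * x0\<^sup>2))) * h"
    using \<open>h > 0\<close> assms(1) by (simp add: real_sqrt_mult abs_mult)
  finally have val: "(\<lambda>p. u p - uh p) \<in> L2 (Omega x0 y0) \<and>
    L2_norm (Omega x0 y0) (\<lambda>p. u p - uh p)
      \<le> \<bar>g\<bar> * x0 * sqrt (x0 * y0 * (2/15 + 2/3 * (1 / (\<alpha> * x0)) + 1 / (\<alpha>\<^sup>2 * x0\<^sup>2))) * h" .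

  \<comment> \<open>Written with \<open>deriv\<close>, this is right even at the mesh nodes, where the interpolant may have a kink
      and its partial derivative is an arbitrary value, still the same for all \<open>y\<close>.\<close>
  define F where "F x = deriv \<phi> x - deriv (\<lambda>t. \<phi> t - E t) x" for x
  have Du: "partial_x u p - partial_x uh p = F (fst p)" if "p \<in> Omega x0 y0" for p
  proof -
    obtain x y where p: "p = (x, y)" by (cases p)
    have "partial_x u p = deriv \<phi> x"
      unfolding partial_x_def p fst_conv snd_conv using near[OF that[unfolded p]]
      by (intro deriv_cong_ev refl) (auto elim!: eventually_mono simp: u)
    moreover have "partial_x uh p = deriv (\<lambda>t. \<phi> t - E t) x"
      unfolding partial_x_def p fst_conv snd_conv using near[OF that[unfolded p]]
      by (intro deriv_cong_ev refl) (auto elim!: eventually_mono simp: uh)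
    ultimately show ?thesis by (simp add: F_def p)
  qed
  have D\<phi>: "(\<phi> has_real_derivative (- g * x + (g * x0 - q))) (at x)" for x
    unfolding \<phi>_def by (auto intro!: derivative_eq_intros)
  have F_cell: "F x = g * ((real k + 1) * h - x)" if "real k * h < x" "x < (real k + 1) * h" for x k
  proof -
    have E: "(E has_real_derivative g * ((real k + 1) * h - x)) (at x)"
      unfolding E_def using error_profile_derivative \<open>h > 0\<close> that by blast
    show ?thesis
      unfolding F_def DERIV_imp_deriv[OF D\<phi>] DERIV_imp_deriv[OF DERIV_diff[OF D\<phi> E]] by simp
  qed
  \<comment> \<open>Cutting off outside \<open>(0, x0)\<close> leaves a function that agrees off the countable set of nodes
      with a Borel function, and hence is Borel.\<close>
  define F' where "F' x = (if x \<in> {0<..<x0} then F x else 0)" for x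
  have F'_meas: "F' \<in> borel_measurable borel"
  proof (rule measurable_discrete_difference)
    show "(\<lambda>x. if x \<in> {0<..<x0} then g * (h - cell_offset h x) else 0) \<in> borel_measurable borel"
      by measurable
    show "countable ((\<lambda>k. real k * h) ` UNIV)" by simp
    show "(if x \<in> {0<..<x0} then g * (h - cell_offset h x) else 0) = F' x"
      if x: "x \<notin> (\<lambda>k. real k * h) ` UNIV" for x
    proof (cases "x \<in> {0<..<x0}")
      case True
      then obtain k where k: "real k * h \<le> x" "x < (real k + 1) * h" "cell_offset h x = x - real k * h"
        using mesh_cell[of h x n] \<open>h > 0\<close> by (auto simp: x0)
      moreover have "real k * h \<noteq> x" using x by auto
      ultimately have "F x = g * ((real k + 1) * h - x)" by (intro F_cell) auto
      also have "(real k + 1) * h - x = h - cell_offset h x"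
        unfolding k(3) by (simp add: algebra_simps)
      finally show ?thesis by (simp add: F'_def)
    next
      case False
      then show ?thesis by (simp only: F'_def if_False)
    qed
  qed auto
  have "((\<lambda>x. (F' x)\<^sup>2) has_integral real n * (g\<^sup>2 * h ^ 3 / 3)) {0..real n * h}"
  proof (rule has_integral_mesh[OF \<open>h > 0\<close>])
    fix k assume "k < n"
    let ?a = "real k * h" and ?b = "(real k + 1) * h"
    have bounds: "0 \<le> ?a" "?a \<le> ?b" "?b \<le> x0"
      using \<open>h > 0\<close> \<open>k < n\<close> by (auto simp: x0 intro!: mult_right_mono)
    have "((\<lambda>x. g\<^sup>2 * (?b - x)\<^sup>2) has_integral
        - (g\<^sup>2 * (?b - ?b) ^ 3 / 3) - - (g\<^sup>2 * (?b - ?a) ^ 3 / 3)) {?a..?b}"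
    proof (rule fundamental_theorem_of_calculus[OF bounds(2)])
      fix x
      have "((\<lambda>x. - (g\<^sup>2 * (?b - x) ^ 3 / 3)) has_real_derivative g\<^sup>2 * (?b - x)\<^sup>2) (at x)"
        by (auto intro!: derivative_eq_intros simp: power2_eq_square)
      then show "((\<lambda>x. - (g\<^sup>2 * (?b - x) ^ 3 / 3)) has_vector_derivative g\<^sup>2 * (?b - x)\<^sup>2)
          (at x within {?a..?b})"
        by (simp add: has_real_derivative_iff_has_vector_derivative has_vector_derivative_at_within)
    qed
    also have "- (g\<^sup>2 * (?b - ?b) ^ 3 / 3) - - (g\<^sup>2 * (?b - ?a) ^ 3 / 3) = g\<^sup>2 * h ^ 3 / 3"
      by (simp add: algebra_simps)
    finally show "((\<lambda>x. (F' x)\<^sup>2) has_integral g\<^sup>2 * h ^ 3 / 3) {?a..?b}"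
    proof (rule has_integral_spike_finite[rotated 2])
      show "finite {?a, ?b}" by simp
      fix x assume "x \<in> {?a..?b} - {?a, ?b}"
      then show "(F' x)\<^sup>2 = g\<^sup>2 * (?b - x)\<^sup>2"
        using bounds F_cell[of k x] by (auto simp: F'_def power_mult_distrib)
    qed
  qed
  then have "((\<lambda>x. (F' x)\<^sup>2) has_integral g\<^sup>2 * h\<^sup>2 * x0 / 3) {0..x0}"
    by (simp add: x0 power2_eq_square power3_eq_cube mult_ac)
  then have "(\<lambda>p. partial_x u p - partial_x uh p) \<in> L2 (Omega x0 y0) \<and>
    L2_norm (Omega x0 y0) (\<lambda>p. partial_x u p - partial_x uh p) \<le> sqrt (y0 * (g\<^sup>2 * h\<^sup>2 * x0 / 3))"
    by (rule L2_norm_le_fst[OF assms(2) F'_meas borel_measurable_power[OF F'_meas]])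
       (auto simp: Du F'_def Omega_def)
  also have "y0 * (g\<^sup>2 * h\<^sup>2 * x0 / 3) = (\<bar>g\<bar> * h)\<^sup>2 * (1/3 * x0 * y0)"
    by (simp add: power_mult_distrib)
  also have "sqrt \<dots> = \<bar>g\<bar> * sqrt (1/3 * x0 * y0) * h"
    using \<open>h > 0\<close> by (subst real_sqrt_mult) (simp add: abs_mult)
  finally show ?thesis using val by simp
qed

end
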